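(* Let $n,m\ge1$ be integers, $l=\min(n,m)$, and let $u\ge v\ge0$ be integers. With $x=(x_1,\dots,x_n)$, $x^{-1}=(x_1^{-1},\dots,x_n^{-1})$ and $y=(y_1,\dots,y_m)$, $$\mathrm{s}^{(n+m)}_{(u^n,v^m)}(x,y)=\Big[\prod_{i=1}^nx_i\Big]^u\Big[\prod_{i=1}^my_i\Big]^v\sum_{\mu\subseteq(u-v)^l}\mathrm{s}^{(n)}_{(\mu,0^{n-l})}(x^{-1})\cdot\mathrm{s}^{(m)}_{(\mu,0^{m-l})}(y).$$
   Context: $\mathrm{s}^{(k)}_\lambda(x_1,\dots,x_k)$ is the usual Schur polynomial in $k$ variables indexed by a partition $\lambda=(\lambda_1\ge\dots\ge\lambda_k\ge0)$ with integer parts. For a number $a$, $a^k$ as an index denotes the $k$-tuple $(a,\dots,a)$, and $(a,b)$ denotes concatenation of tuples, so $(u^n,v^m)=(u,\dots,u,v,\dots,v)$. The sum over $\mu\subseteq(u-v)^l$ is over all integer tuples $\mu=(\mu_1,\dots,\mu_l)$ with $u-v\ge\mu_1\ge\dots\ge\mu_l\ge0$. *)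

theory Defs
  imports Complex_Main "HOL-Library.FuncSet"
begin

text \<open>
  A partition with \<open>k\<close> parts (zeros allowed) is a weakly decreasing list of natural numbers
  of length \<open>k\<close>. Rows, columns and tableau entries are numbered from \<open>0\<close>.
\<close>

definition young_diagram :: "nat list \<Rightarrow> (nat \<times> nat) set" where
  "young_diagram \<nu> = {(i, j). i < length \<nu> \<and> j < \<nu> ! i}"

text \<open>
  Tableaux are extensional functions on the diagram, so that each filling is represented by
  exactly one function.
\<close>

definition ssyt :: "nat list \<Rightarrow> nat \<Rightarrow> (nat \<times> nat \<Rightarrow> nat) set" where
  "ssyt \<nu> k = {T \<in> young_diagram \<nu> \<rightarrow>\<^sub>E {..<k}.
     (\<forall>i j j'. j < j' \<and> (i, j) \<in> young_diagram \<nu> \<and> (i, j') \<in> young_diagram \<nu>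
        \<longrightarrow> T (i, j) \<le> T (i, j')) \<and>
     (\<forall>i i' j. i < i' \<and> (i, j) \<in> young_diagram \<nu> \<and> (i', j) \<in> young_diagram \<nu>
        \<longrightarrow> T (i, j) < T (i', j))}"

text \<open>
  The value of the Schur polynomial of \<open>\<nu>\<close> in \<open>k = length xs\<close> variables at the point \<open>xs\<close>,
  as the generating function of semistandard Young tableaux of shape \<open>\<nu>\<close>; entry \<open>t\<close>
  contributes the variable \<open>xs ! t\<close>.
  Unlike the quotient of alternants, this makes sense at every point, including points with
  repeated coordinates.
\<close>

definition schur :: "nat list \<Rightarrow> 'a::comm_semiring_1 list \<Rightarrow> 'a" where
  "schur \<nu> xs = (\<Sum>T\<in>ssyt \<nu> (length xs). \<Prod>c\<in>young_diagram \<nu>. xs ! T c)"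

definition partitions_in_box :: "nat \<Rightarrow> nat \<Rightarrow> nat list set" where
  "partitions_in_box l c = {\<mu>. length \<mu> = l \<and> sorted_wrt (\<ge>) \<mu> \<and> (\<forall>p\<in>set \<mu>. p \<le> c)}"

text \<open>The index sets of the sums and products above are finite, so none of them is vacuous.\<close>

lemma finite_young_diagram: "finite (young_diagram \<nu>)"
proof -
  have "young_diagram \<nu> = (SIGMA i:{..<length \<nu>}. {..<\<nu> ! i})"
    by (auto simp: young_diagram_def)
  then show ?thesis by simp
qed

lemma finite_ssyt: "finite (ssyt \<nu> k)"
  by (rule finite_subset[OF _ finite_PiE[OF finite_young_diagram[of \<nu>], of "\<lambda>_. {..<k}"]])
    (auto simp: ssyt_def)

lemma finite_partitions_in_box: "finite (partitions_in_box l c)"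
  by (rule finite_subset[OF _ finite_lists_length_eq[of "{..c}" l]])
    (auto simp: partitions_in_box_def)

end

theory Submission imports Defs begin

text \<open>
  By the branching rule, a Schur polynomial is a sum over chains of shapes in which consecutive
  shapes differ by horizontal strips. Split such a chain for \<open>(u\<^sup>n, v\<^sup>m)\<close> at the shape \<open>\<kappa>\<close> carrying
  the variables \<open>x\<close>. Then \<open>\<kappa>\<close> has at most \<open>n\<close> rows, all of length between \<open>v\<close> and \<open>u\<close>. Let \<open>\<nu>\<close> be
  the complement of \<open>\<kappa>\<close> in the rectangle \<open>u\<^sup>n\<close>, rotated by 180 degrees. Complementation preserves
  interlacing, so the lower part of the chain gives \<open>s\<^sub>\<kappa>(x) = (\<Prod>x)\<^sup>u s\<^sub>\<nu>(x\<^sup>-\<^sup>1)\<close>, and it reverses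
  horizontal strips, so the upper part gives \<open>(\<Prod>y)\<^sup>v s\<^sub>\<nu>\<close> with the variables \<open>y\<close> in the opposite
  order. That order is irrelevant because Schur polynomials are symmetric, by the Bender--Knuth
  involution.
\<close>

section \<open>Horizontal strips and the branching rule\<close>

text \<open>For a partition \<open>\<nu>\<close> these are the shapes for which
  \<open>\<nu>/\<kappa>\<close> is a horizontal strip. Keeping the length fixed, zeros included,
  lets whole chains of shapes live in one finite box.\<close>

definition strips :: "nat list \<Rightarrow> nat list set" where
  "strips \<nu> = {\<kappa>. length \<kappa> = length \<nu> \<and> (\<forall>i<length \<nu>. \<kappa> ! i \<le> \<nu> ! i) \<and>
     (\<forall>i. Suc i < length \<nu> \<longrightarrow> \<nu> ! Suc i \<le> \<kappa> ! i)}"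

lemma stripsD:
  assumes "\<kappa> \<in> strips \<nu>"
  shows "length \<kappa> = length \<nu>" "i < length \<nu> \<Longrightarrow> \<kappa> ! i \<le> \<nu> ! i"
    "Suc i < length \<nu> \<Longrightarrow> \<nu> ! Suc i \<le> \<kappa> ! i"
  using assms by (auto simp: strips_def)

lemma sorted_ge_iff_Suc:
  "sorted_wrt (\<ge>) (xs :: nat list) \<longleftrightarrow> (\<forall>i. Suc i < length xs \<longrightarrow> xs ! Suc i \<le> xs ! i)"
  by (subst sorted_wrt_iff_nth_Suc_transp) (auto intro: transpI)

lemma sorted_ge_nth:
  "sorted_wrt (\<ge>) (xs :: nat list) \<Longrightarrow> i \<le> j \<Longrightarrow> j < length xs \<Longrightarrow> xs ! j \<le> xs ! i"
  by (cases "i = j") (auto simp: sorted_wrt_iff_nth_less)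

text \<open>Two neighbouring parts are separated by a part of the larger shape:
  \<open>\<kappa> ! Suc i \<le> \<nu> ! Suc i \<le> \<kappa> ! i\<close>.\<close>

lemma sorted_strips: "\<kappa> \<in> strips \<nu> \<Longrightarrow> sorted_wrt (\<ge>) \<kappa>"
  unfolding sorted_ge_iff_Suc by (metis Suc_lessD le_trans stripsD)

lemma sum_list_strips_le: "\<kappa> \<in> strips \<nu> \<Longrightarrow> sum_list \<kappa> \<le> sum_list \<nu>"
  by (auto simp: strips_def sum_list_sum_nth intro!: sum_mono)

lemma partitions_in_box_iff:
  "\<mu> \<in> partitions_in_box l c \<longleftrightarrow> length \<mu> = l \<and> sorted_wrt (\<ge>) \<mu> \<and> (\<forall>i<l. \<mu> ! i \<le> c)"
  by (auto simp: partitions_in_box_def all_set_conv_all_nth)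

lemma strips_subset_box:
  "\<nu> \<in> partitions_in_box n u \<Longrightarrow> strips \<nu> \<subseteq> partitions_in_box n u"
proof
  fix \<kappa> assume b: "\<nu> \<in> partitions_in_box n u" and k: "\<kappa> \<in> strips \<nu>"
  have "\<kappa> ! i \<le> u" if "i < n" for i
    using stripsD(2)[OF k, of i] b that by (force simp: partitions_in_box_iff)
  then show "\<kappa> \<in> partitions_in_box n u"
    using b stripsD(1)[OF k] sorted_strips[OF k] by (simp add: partitions_in_box_iff)
qed

lemma finite_strips: "finite (strips \<nu>)"
proof (rule finite_subset)
  show "strips \<nu> \<subseteq> {\<kappa>. set \<kappa> \<subseteq> {..Max (set \<nu>)} \<and> length \<kappa> = length \<nu>}"
  proof
    fix \<kappa> assume k: "\<kappa> \<in> strips \<nu>"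
    have "\<kappa> ! i \<le> Max (set \<nu>)" if "i < length \<nu>" for i
      using stripsD(2)[OF k that] that by (meson List.finite_set Max_ge le_trans nth_mem)
    then show "\<kappa> \<in> {\<kappa>. set \<kappa> \<subseteq> {..Max (set \<nu>)} \<and> length \<kappa> = length \<nu>}"
      using stripsD(1)[OF k] by (auto simp: in_set_conv_nth)
  qed
qed (rule finite_lists_length_eq, simp)

section \<open>Diagrams, tableaux and vanishing\<close>

lemma card_young_diagram: "card (young_diagram \<nu>) = sum_list \<nu>"
proof -
  have "young_diagram \<nu> = (SIGMA i:{..<length \<nu>}. {..<\<nu> ! i})"
    by (auto simp: young_diagram_def)
  then show ?thesis by (simp add: sum_list_sum_nth atLeast0LessThan)
qed

lemma young_diagram_strip_subset: "\<kappa> \<in> strips \<nu> \<Longrightarrow> young_diagram \<kappa> \<subseteq> young_diagram \<nu>"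
  by (force simp: young_diagram_def strips_def)

lemma young_diagram_up:
  assumes "sorted_wrt (\<ge>) \<nu>" "i \<le> i'" "(i', j) \<in> young_diagram \<nu>"
  shows "(i, j) \<in> young_diagram \<nu>"
  using assms(2,3) sorted_ge_nth[OF assms(1,2)] by (auto simp: young_diagram_def)

lemma schur_cong_diagram:
  "young_diagram \<mu> = young_diagram \<nu> \<Longrightarrow> schur \<mu> xs = schur \<nu> xs"
  by (simp add: schur_def ssyt_def)

lemma schur_append_zeros: "schur (\<mu> @ replicate k 0) xs = schur \<mu> xs"
  by (rule schur_cong_diagram) (auto simp: young_diagram_def nth_append split: if_splits)

lemma ssytD:
  assumes "T \<in> ssyt \<nu> k"
  shows "(i, j) \<in> young_diagram \<nu> \<Longrightarrow> T (i, j) < k"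
    and "j \<le> j' \<Longrightarrow> (i, j) \<in> young_diagram \<nu> \<Longrightarrow> (i, j') \<in> young_diagram \<nu> \<Longrightarrow> T (i, j) \<le> T (i, j')"
    and "i < i' \<Longrightarrow> (i, j) \<in> young_diagram \<nu> \<Longrightarrow> (i', j) \<in> young_diagram \<nu> \<Longrightarrow> T (i, j) < T (i', j)"
    and "c \<notin> young_diagram \<nu> \<Longrightarrow> T c = undefined"
proof -
  show "(i, j) \<in> young_diagram \<nu> \<Longrightarrow> T (i, j) < k"
    using assms by (auto simp: ssyt_def PiE_iff)
  show "j \<le> j' \<Longrightarrow> (i, j) \<in> young_diagram \<nu> \<Longrightarrow> (i, j') \<in> young_diagram \<nu> \<Longrightarrow> T (i, j) \<le> T (i, j')"
    using assms by (cases "j = j'") (auto simp: ssyt_def)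
  show "i < i' \<Longrightarrow> (i, j) \<in> young_diagram \<nu> \<Longrightarrow> (i', j) \<in> young_diagram \<nu> \<Longrightarrow> T (i, j) < T (i', j)"
    using assms by (auto simp: ssyt_def)
  show "c \<notin> young_diagram \<nu> \<Longrightarrow> T c = undefined"
    using assms unfolding ssyt_def by (cases c) (auto simp: PiE_iff extensional_def)
qed

lemma ssytI:
  assumes "\<And>i j. (i, j) \<in> young_diagram \<nu> \<Longrightarrow> T (i, j) < k"
    and "\<And>i j j'. j < j' \<Longrightarrow> (i, j) \<in> young_diagram \<nu> \<Longrightarrow> (i, j') \<in> young_diagram \<nu> \<Longrightarrow> T (i, j) \<le> T (i, j')"
    and "\<And>i i' j. i < i' \<Longrightarrow> (i, j) \<in> young_diagram \<nu> \<Longrightarrow> (i', j) \<in> young_diagram \<nu> \<Longrightarrow> T (i, j) < T (i', j)"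
    and "\<And>c. c \<notin> young_diagram \<nu> \<Longrightarrow> T c = undefined"
  shows "T \<in> ssyt \<nu> k"
  using assms unfolding ssyt_def by (auto simp: PiE_iff extensional_def)

text \<open>Sortedness puts every cell above \<open>(i, j)\<close> into the diagram, and strictness
  in the column raises the entry by at least one with each row.\<close>

lemma ssyt_entry_ge_row:
  assumes "T \<in> ssyt \<nu> k" "sorted_wrt (\<ge>) \<nu>" "(i, j) \<in> young_diagram \<nu>"
  shows "i \<le> T (i, j)"
  using assms(3)
proof (induction i)
  case (Suc i)
  then have "(i, j) \<in> young_diagram \<nu>"
    by (intro young_diagram_up[OF assms(2), of i "Suc i"]) auto
  then show ?case
    using Suc ssytD(3)[OF assms(1), of i "Suc i" j] by force
qed simp

text \<open>The first cell of row \<open>length xs\<close> would need an entry of at least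
  \<open>length xs\<close>, which is outside the alphabet. This discards shapes with too many rows
  from the sums below.\<close>

lemma schur_eq_0:
  assumes "sorted_wrt (\<ge>) \<nu>" "length xs < length \<nu>" "\<nu> ! length xs > 0"
  shows "schur \<nu> xs = 0"
proof -
  have "(length xs, 0) \<in> young_diagram \<nu>"
    using assms by (auto simp: young_diagram_def)
  then have "ssyt \<nu> (length xs) = {}"
    using ssyt_entry_ge_row[OF _ assms(1)] ssytD(1) by (metis all_not_in_conv leD)
  then show ?thesis by (simp add: schur_def)
qed

lemma schur_Nil:
  "schur \<nu> [] = (of_bool (\<nu> = replicate (length \<nu>) 0) :: 'a::comm_semiring_1)"
proof (cases "\<nu> = replicate (length \<nu>) 0")
  case True
  then have "young_diagram \<nu> = {}"
    by (auto simp: young_diagram_def) (metis less_nat_zero_code nth_replicate)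
  then have "schur \<nu> [] = (1::'a)"
    by (simp add: schur_def ssyt_def)
  with True show ?thesis by simp
next
  case False
  then obtain i where "i < length \<nu>" "\<nu> ! i > 0"
    by (metis gr_zeroI length_replicate nth_equalityI nth_replicate)
  then have "(i, 0) \<in> young_diagram \<nu>"
    by (auto simp: young_diagram_def)
  then have "ssyt \<nu> 0 = {}"
    using ssytD(1) by fastforce
  with False show ?thesis by (simp add: schur_def)
qed

section \<open>Removing the cells with the largest entry\<close>

definition trim_shape :: "nat list \<Rightarrow> nat \<Rightarrow> (nat \<times> nat \<Rightarrow> nat) \<Rightarrow> nat list" where
  "trim_shape \<nu> k T = map (\<lambda>i. card {j. j < \<nu> ! i \<and> T (i, j) < k}) [0..<length \<nu>]"

lemma down_closed_eq_lessThan: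
  assumes "finite (A :: nat set)" "\<And>i j. i \<le> j \<Longrightarrow> j \<in> A \<Longrightarrow> i \<in> A"
  shows "A = {..<card A}"
proof (cases "A = {}")
  case False
  have "A = {..Max A}"
    using assms False by (auto intro: assms(2)[OF _ Max_in])
  then show ?thesis
    by (metis card_atMost lessThan_Suc_atMost)
qed simp

text \<open>Rows increase weakly, so the cells counted by \<open>trim_shape\<close> form an initial
  segment of each row and are determined by their number.\<close>

lemma trim_shape_mem:
  assumes "T \<in> ssyt \<nu> (Suc k)"
  shows "(i, j) \<in> young_diagram (trim_shape \<nu> k T) \<longleftrightarrow>
    (i, j) \<in> young_diagram \<nu> \<and> T (i, j) < k"
proof (cases "i < length \<nu>")
  case True
  let ?A = "{j. j < \<nu> ! i \<and> T (i, j) < k}"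
  have "?A = {..<card ?A}"
  proof (rule down_closed_eq_lessThan)
    fix a b assume "a \<le> b" "b \<in> ?A"
    then show "a \<in> ?A"
      using ssytD(2)[OF assms, of a b i] True by (auto simp: young_diagram_def)
  qed auto
  then have "j < card ?A \<longleftrightarrow> j \<in> ?A" by blast
  then show ?thesis
    using True by (auto simp: young_diagram_def trim_shape_def)
qed (auto simp: young_diagram_def trim_shape_def)

text \<open>The test column is \<open>\<nu> ! i'\<close>, the first one missing from row
  \<open>i'\<close> of \<open>\<nu>\<close>. This turns inclusions of diagrams into inequalities
  between row lengths.\<close>

lemma nth_le_if_diagram:
  assumes "\<And>j. (i, j) \<in> young_diagram \<mu> \<Longrightarrow> (i', j) \<in> young_diagram \<nu>"
    and "i < length \<mu>" "i' < length \<nu>"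
  shows "\<mu> ! i \<le> \<nu> ! i'"
  using assms(1)[of "\<nu> ! i'"] assms(2,3) by (auto simp: young_diagram_def not_less[symmetric])

lemma length_trim_shape [simp]: "length (trim_shape \<nu> k T) = length \<nu>"
  by (simp add: trim_shape_def)

text \<open>Entries are at most \<open>k\<close> and columns are strict, so a cell with another one
  directly below it has an entry less than \<open>k\<close> and survives the trimming.\<close>

lemma trim_shape_strips:
  assumes T: "T \<in> ssyt \<nu> (Suc k)" and s: "sorted_wrt (\<ge>) \<nu>"
  shows "trim_shape \<nu> k T \<in> strips \<nu>"
proof -
  have "trim_shape \<nu> k T ! i \<le> \<nu> ! i" if "i < length \<nu>" for i
    by (rule nth_le_if_diagram) (use that in \<open>auto simp: trim_shape_mem[OF T]\<close>)
  moreover have "\<nu> ! Suc i \<le> trim_shape \<nu> k T ! i" if "Suc i < length \<nu>" for i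
  proof (rule nth_le_if_diagram)
    fix j assume j: "(Suc i, j) \<in> young_diagram \<nu>"
    then have "(i, j) \<in> young_diagram \<nu>"
      by (intro young_diagram_up[OF s, of i "Suc i"]) auto
    then show "(i, j) \<in> young_diagram (trim_shape \<nu> k T)"
      using ssytD(1)[OF T j] ssytD(3)[OF T, of i "Suc i" j] j
      by (simp add: trim_shape_mem[OF T])
  qed (use that in auto)
  ultimately show ?thesis by (simp add: strips_def)
qed

text \<open>The value \<open>undefined\<close> outside \<open>\<nu>\<close> keeps the filling
  extensional, as \<open>ssyt\<close> demands.\<close>

definition extend_tableau ::
  "nat list \<Rightarrow> nat \<Rightarrow> nat list \<Rightarrow> (nat \<times> nat \<Rightarrow> nat) \<Rightarrow> nat \<times> nat \<Rightarrow> nat" where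
  "extend_tableau \<nu> k \<kappa> T c =
     (if c \<in> young_diagram \<kappa> then T c else if c \<in> young_diagram \<nu> then k else undefined)"

lemma extend_tableau_ssyt:
  assumes \<kappa>: "\<kappa> \<in> strips \<nu>" and s: "sorted_wrt (\<ge>) \<nu>" and T: "T \<in> ssyt \<kappa> k"
  shows "extend_tableau \<nu> k \<kappa> T \<in> ssyt \<nu> (Suc k)"
proof (rule ssytI)
  fix i j assume "(i, j) \<in> young_diagram \<nu>"
  then show "extend_tableau \<nu> k \<kappa> T (i, j) < Suc k"
    using ssytD(1)[OF T, of i j] by (auto simp: extend_tableau_def)
next
  fix i j j' :: nat
  assume "j < j'" and ij: "(i, j) \<in> young_diagram \<nu>" "(i, j') \<in> young_diagram \<nu>"
  moreover have "(i, j') \<in> young_diagram \<kappa> \<Longrightarrow> (i, j) \<in> young_diagram \<kappa>"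
    using \<open>j < j'\<close> by (auto simp: young_diagram_def)
  ultimately show "extend_tableau \<nu> k \<kappa> T (i, j) \<le> extend_tableau \<nu> k \<kappa> T (i, j')"
    using ssytD(2)[OF T, of j j' i] ssytD(1)[OF T, of i j] by (auto simp: extend_tableau_def)
next
  fix i i' j :: nat
  assume i: "i < i'" and ij: "(i, j) \<in> young_diagram \<nu>" "(i', j) \<in> young_diagram \<nu>"
  \<comment> \<open>A cell with another cell of \<open>\<nu>\<close> below it already lies in
    \<open>\<kappa>\<close>, so no column receives the new entry \<open>k\<close> twice.\<close>
  have "\<nu> ! i' \<le> \<nu> ! Suc i"
    using i ij s by (intro sorted_ge_nth) (auto simp: young_diagram_def)
  also have "\<dots> \<le> \<kappa> ! i"
    using i ij by (intro stripsD(3)[OF \<kappa>]) (auto simp: young_diagram_def)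
  finally have "(i, j) \<in> young_diagram \<kappa>"
    using ij stripsD(1)[OF \<kappa>] by (auto simp: young_diagram_def)
  then show "extend_tableau \<nu> k \<kappa> T (i, j) < extend_tableau \<nu> k \<kappa> T (i', j)"
    using ssytD(3)[OF T i, of j] ssytD(1)[OF T, of i j] ij by (auto simp: extend_tableau_def)
next
  fix c assume "c \<notin> young_diagram \<nu>"
  then show "extend_tableau \<nu> k \<kappa> T c = undefined"
    using young_diagram_strip_subset[OF \<kappa>] by (auto simp: extend_tableau_def)
qed

lemma trim_shape_extend_tableau:
  assumes \<kappa>: "\<kappa> \<in> strips \<nu>" and s: "sorted_wrt (\<ge>) \<nu>" and T: "T \<in> ssyt \<kappa> k"
  shows "trim_shape \<nu> k (extend_tableau \<nu> k \<kappa> T) = \<kappa>"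
proof -
  note E = trim_shape_mem[OF extend_tableau_ssyt[OF assms]]
  have mem: "c \<in> young_diagram (trim_shape \<nu> k (extend_tableau \<nu> k \<kappa> T)) \<longleftrightarrow> c \<in> young_diagram \<kappa>" for c
    using ssytD(1)[OF T, of "fst c" "snd c"] young_diagram_strip_subset[OF \<kappa>] E[of "fst c" "snd c"]
    by (auto simp: extend_tableau_def)
  show ?thesis
    using stripsD(1)[OF \<kappa>] mem
    by (intro nth_equalityI antisym nth_le_if_diagram) auto
qed

text \<open>The cells carrying the largest entry form a horizontal strip.\<close>

lemma schur_snoc:
  fixes z :: "'a::comm_semiring_1"
  assumes s: "sorted_wrt (\<ge>) \<nu>"
  shows "schur \<nu> (xs @ [z]) =
    (\<Sum>\<kappa>\<in>strips \<nu>. z ^ (sum_list \<nu> - sum_list \<kappa>) * schur \<kappa> xs)"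
proof -
  let ?k = "length xs"
  \<comment> \<open>The inverse of \<open>extend_tableau\<close>: keep the shape and the filling
    formed by the entries below \<open>?k\<close>.\<close>
  let ?r = "\<lambda>T. (trim_shape \<nu> ?k T, restrict T (young_diagram (trim_shape \<nu> ?k T)))"
  have "(\<Sum>\<kappa>\<in>strips \<nu>. z ^ (sum_list \<nu> - sum_list \<kappa>) * schur \<kappa> xs) =
      (\<Sum>(\<kappa>, T)\<in>Sigma (strips \<nu>) (\<lambda>\<kappa>. ssyt \<kappa> ?k).
        z ^ (sum_list \<nu> - sum_list \<kappa>) * (\<Prod>c\<in>young_diagram \<kappa>. xs ! T c))"
    by (simp add: schur_def sum_distrib_left sum.Sigma finite_strips finite_ssyt)
  also have "\<dots> = (\<Sum>T\<in>ssyt \<nu> (Suc ?k). \<Prod>c\<in>young_diagram \<nu>. (xs @ [z]) ! T c)"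
  proof (rule sum.reindex_bij_witness[where i = ?r and j = "\<lambda>(\<kappa>, T). extend_tableau \<nu> ?k \<kappa> T"], goal_cases)
    case (1 p)
    obtain \<kappa> T where p: "p = (\<kappa>, T)" by force
    with 1 have \<kappa>: "\<kappa> \<in> strips \<nu>" and T: "T \<in> ssyt \<kappa> ?k" by auto
    have "restrict (extend_tableau \<nu> ?k \<kappa> T) (young_diagram \<kappa>) = T"
      using ssytD(4)[OF T] by (auto simp: extend_tableau_def restrict_def)
    then show ?case by (simp add: p trim_shape_extend_tableau[OF \<kappa> s T])
  next
    case (2 p)
    then show ?case using extend_tableau_ssyt[OF _ s] by auto
  next
    case (3 T)
    show ?case
    proof
      fix c
      show "(case ?r T of (\<kappa>, T) \<Rightarrow> extend_tableau \<nu> ?k \<kappa> T) c = T c"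
        using trim_shape_mem[OF 3, of "fst c" "snd c"] ssytD(1)[OF 3, of "fst c" "snd c"]
          ssytD(4)[OF 3, of c]
        by (auto simp: extend_tableau_def)
    qed
  next
    case (4 T)
    have "restrict T (young_diagram (trim_shape \<nu> ?k T)) \<in> ssyt (trim_shape \<nu> ?k T) ?k"
      using ssytD[OF 4] by (intro ssytI) (auto simp: trim_shape_mem[OF 4])
    then show ?case using trim_shape_strips[OF 4 s] by auto
  next
    case (5 p)
    obtain \<kappa> T where p: "p = (\<kappa>, T)" by force
    with 5 have \<kappa>: "\<kappa> \<in> strips \<nu>" and T: "T \<in> ssyt \<kappa> ?k" by auto
    note sub = young_diagram_strip_subset[OF \<kappa>]
    let ?f = "\<lambda>c. (xs @ [z]) ! extend_tableau \<nu> ?k \<kappa> T c"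
    have "(\<Prod>c\<in>young_diagram \<nu>. ?f c) =
        (\<Prod>c\<in>young_diagram \<nu> - young_diagram \<kappa>. ?f c) * (\<Prod>c\<in>young_diagram \<kappa>. ?f c)"
      by (rule prod.subset_diff[OF sub finite_young_diagram])
    also have "(\<Prod>c\<in>young_diagram \<kappa>. ?f c) = (\<Prod>c\<in>young_diagram \<kappa>. xs ! T c)"
      using ssytD(1)[OF T] by (intro prod.cong) (auto simp: extend_tableau_def nth_append)
    also have "(\<Prod>c\<in>young_diagram \<nu> - young_diagram \<kappa>. ?f c) =
        (\<Prod>c\<in>young_diagram \<nu> - young_diagram \<kappa>. z)"
      by (intro prod.cong) (auto simp: extend_tableau_def)
    also have "\<dots> = z ^ (sum_list \<nu> - sum_list \<kappa>)"
      by (simp add: card_Diff_subset[OF finite_young_diagram sub] card_young_diagram)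
    finally show ?case by (simp add: p)
  qed
  finally show ?thesis by (simp add: schur_def)
qed

section \<open>Interlacing rows and complements in a rectangle\<close>

text \<open>The rows that may stand directly below \<open>\<nu>\<close> in a Gelfand-Tsetlin
  pattern. Unlike in \<open>strips\<close> the length drops by one; in this form interlacing keeps
  its direction under complementation.\<close>

definition gt_rows :: "nat list \<Rightarrow> nat list set" where
  "gt_rows \<nu> = {a. Suc (length a) = length \<nu> \<and>
     (\<forall>i<length a. \<nu> ! Suc i \<le> a ! i \<and> a ! i \<le> \<nu> ! i)}"

lemma snoc_0_strips_iff: "length \<nu> = Suc (length a) \<Longrightarrow> a @ [0] \<in> strips \<nu> \<longleftrightarrow> a \<in> gt_rows \<nu>"
  by (auto simp: strips_def gt_rows_def nth_append less_Suc_eq) (metis Suc_lessI lessI)+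

text \<open>There are as many variables as parts. A strip whose last part is positive has too many
  rows for the remaining variables, so only shapes \<open>a @ [0]\<close> survive in the branching
  rule.\<close>

lemma schur_snoc_gt:
  fixes z :: "'a::comm_semiring_1"
  assumes s: "sorted_wrt (\<ge>) \<nu>" and len: "length \<nu> = Suc (length xs)"
  shows "schur \<nu> (xs @ [z]) =
    (\<Sum>a\<in>gt_rows \<nu>. z ^ (sum_list \<nu> - sum_list a) * schur a xs)"
proof -
  let ?f = "\<lambda>\<kappa>. z ^ (sum_list \<nu> - sum_list \<kappa>) * schur \<kappa> xs"
  have "schur \<nu> (xs @ [z]) = sum ?f (strips \<nu>)"
    by (rule schur_snoc[OF s])
  also have "\<dots> = sum ?f ((\<lambda>a. a @ [0]) ` gt_rows \<nu>)"
  proof (rule sum.mono_neutral_right[OF finite_strips])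
    show "(\<lambda>a. a @ [0]) ` gt_rows \<nu> \<subseteq> strips \<nu>"
      by (auto simp: gt_rows_def snoc_0_strips_iff)
    show "\<forall>\<kappa>\<in>strips \<nu> - (\<lambda>a. a @ [0]) ` gt_rows \<nu>. ?f \<kappa> = 0"
    proof
      fix \<kappa> assume \<kappa>: "\<kappa> \<in> strips \<nu> - (\<lambda>a. a @ [0]) ` gt_rows \<nu>"
      then have l: "length \<kappa> = Suc (length xs)"
        using len by (simp add: strips_def)
      then obtain a p where ap: "\<kappa> = a @ [p]" "length a = length xs"
        by (metis length_Suc_conv_rev)
      have "p > 0"
        using \<kappa> ap len by (cases "p = 0") (auto simp: snoc_0_strips_iff)
      then have "schur \<kappa> xs = 0"
        using \<kappa> ap by (intro schur_eq_0 sorted_strips[of \<kappa> \<nu>]) (auto simp: nth_append)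
      then show "?f \<kappa> = 0" by simp
    qed
  qed
  also have "\<dots> = (\<Sum>a\<in>gt_rows \<nu>. ?f (a @ [0]))"
    by (subst sum.reindex) (auto simp: inj_on_def)
  also have "\<dots> = (\<Sum>a\<in>gt_rows \<nu>. z ^ (sum_list \<nu> - sum_list a) * schur a xs)"
    using schur_append_zeros[of _ 1 xs] by simp
  finally show ?thesis .
qed

section \<open>Complements in a rectangle\<close>

definition box_compl :: "nat \<Rightarrow> nat list \<Rightarrow> nat list" where
  "box_compl u \<kappa> = map (\<lambda>p. u - p) (rev \<kappa>)"

lemma length_box_compl [simp]: "length (box_compl u \<kappa>) = length \<kappa>"
  by (simp add: box_compl_def)

lemma nth_box_compl: "i < length \<kappa> \<Longrightarrow> box_compl u \<kappa> ! i = u - \<kappa> ! (length \<kappa> - Suc i)"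
  by (simp add: box_compl_def rev_nth)

lemma box_compl_in_box: "\<kappa> \<in> partitions_in_box n u \<Longrightarrow> box_compl u \<kappa> \<in> partitions_in_box n u"
  by (auto simp: partitions_in_box_iff sorted_wrt_iff_nth_less nth_box_compl intro!: diff_le_mono2)

text \<open>All parts are at most \<open>u\<close>, so the truncated subtraction loses
  nothing.\<close>

lemma box_compl_box_compl: "\<kappa> \<in> partitions_in_box n u \<Longrightarrow> box_compl u (box_compl u \<kappa>) = \<kappa>"
  by (intro nth_equalityI) (auto simp: partitions_in_box_iff nth_box_compl)

lemma sum_list_box_compl:
  assumes "\<kappa> \<in> partitions_in_box n u"
  shows "sum_list (box_compl u \<kappa>) + sum_list \<kappa> = n * u"
proof -
  have "\<forall>p\<in>set \<kappa>. p \<le> u" "length \<kappa> = n"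
    using assms by (auto simp: partitions_in_box_def)
  then show ?thesis
    by (induction \<kappa> arbitrary: n) (auto simp: box_compl_def)
qed

text \<open>Subtracting from \<open>u\<close> turns both interlacing inequalities around, and
  reversing the lists exchanges the two neighbours of each part, so the inequalities trade
  places.\<close>

lemma box_compl_gt_rows:
  assumes "\<nu> \<in> partitions_in_box n u" "a \<in> gt_rows \<nu>"
  shows "box_compl u a \<in> gt_rows (box_compl u \<nu>)"
proof -
  have l: "length \<nu> = Suc (length a)"
    using assms(2) by (simp add: gt_rows_def)
  have "\<nu> ! (length a - i) \<le> a ! (length a - Suc i)"
    "a ! (length a - Suc i) \<le> \<nu> ! (length a - Suc i)" if "i < length a" for i
    using assms(2) that Suc_diff_Suc[OF that] unfolding gt_rows_def
    by (auto dest!: spec[of _ "length a - Suc i"])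
  then show ?thesis
    by (auto simp: gt_rows_def nth_box_compl l intro!: diff_le_mono2)
qed

lemma gt_rows_in_box:
  assumes "\<nu> \<in> partitions_in_box (Suc n) u" "a \<in> gt_rows \<nu>"
  shows "a \<in> partitions_in_box n u"
proof -
  have "a @ [0] \<in> partitions_in_box (Suc n) u"
    using assms strips_subset_box[OF assms(1)] snoc_0_strips_iff[of \<nu> a] by (auto simp: gt_rows_def)
  then show ?thesis
    by (auto simp: partitions_in_box_def sorted_wrt_append)
qed

text \<open>The second bound holds because \<open>a\<close> dominates \<open>\<nu>\<close> without
  its first part, which is at most \<open>u\<close>. Hence the exponent of a variable lies between
  \<open>0\<close> and \<open>u\<close>.\<close>

lemma gt_rows_sum_le:
  assumes "\<nu> \<in> partitions_in_box (Suc n) u" "a \<in> gt_rows \<nu>"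
  shows "sum_list a \<le> sum_list \<nu>" "sum_list \<nu> \<le> sum_list a + u"
proof -
  have l: "length \<nu> = Suc n" "length a = n" "\<nu> ! 0 \<le> u"
    using assms by (auto simp: partitions_in_box_iff gt_rows_def)
  have "sum_list \<nu> = \<nu> ! 0 + (\<Sum>i<n. \<nu> ! Suc i)"
    unfolding sum_list_sum_nth atLeast0LessThan l by (rule sum.lessThan_Suc_shift)
  also have "(\<Sum>i<n. \<nu> ! Suc i) \<le> (\<Sum>i<n. a ! i)"
    using assms l by (intro sum_mono) (auto simp: gt_rows_def)
  finally show "sum_list \<nu> \<le> sum_list a + u"
    using l by (simp add: sum_list_sum_nth atLeast0LessThan)
  have "(\<Sum>i<n. a ! i) \<le> (\<Sum>i<n. \<nu> ! i)"
    using assms l by (intro sum_mono) (auto simp: gt_rows_def)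
  then show "sum_list a \<le> sum_list \<nu>"
    using l by (simp add: sum_list_sum_nth atLeast0LessThan)
qed

text \<open>Complementing a Gelfand-Tsetlin pattern row by row changes the exponent \<open>e\<close>
  of each variable into \<open>u - e\<close>; the induction removes one variable, that is one row of
  the pattern, at a time.\<close>

lemma schur_box_compl:
  fixes xs :: "'a::field list"
  assumes "\<nu> \<in> partitions_in_box (length xs) u" "0 \<notin> set xs"
  shows "schur \<nu> xs = prod_list xs ^ u * schur (box_compl u \<nu>) (map inverse xs)"
  using assms
proof (induction xs arbitrary: \<nu> rule: rev_induct)
  case Nil
  then show ?case by (simp add: partitions_in_box_def box_compl_def)
next
  case (snoc z xs)
  let ?n = "length xs"
  let ?c = "box_compl u"
  have \<nu>: "\<nu> \<in> partitions_in_box (Suc ?n) u" and z: "z \<noteq> 0" and xs: "0 \<notin> set xs"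
    using snoc.prems by auto
  note c\<nu> = box_compl_in_box[OF \<nu>]
  have box: "a \<in> partitions_in_box ?n u" if "a \<in> gt_rows \<nu>" for a
    using gt_rows_in_box[OF \<nu> that] .
  have "schur (?c \<nu>) (map inverse (xs @ [z])) =
      (\<Sum>a\<in>gt_rows (?c \<nu>). inverse z ^ (sum_list (?c \<nu>) - sum_list a) * schur a (map inverse xs))"
    using c\<nu> by (simp, subst schur_snoc_gt) (auto simp: partitions_in_box_def)
  also have "\<dots> = (\<Sum>a\<in>gt_rows \<nu>.
      inverse z ^ (sum_list (?c \<nu>) - sum_list (?c a)) * schur (?c a) (map inverse xs))"
    using box_compl_gt_rows[OF \<nu>] box_compl_gt_rows[OF c\<nu>] box gt_rows_in_box[OF c\<nu>]
    by (intro sum.reindex_bij_witness[where i = ?c and j = ?c])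
      (auto simp: box_compl_box_compl[of _ ?n u] box_compl_box_compl[OF \<nu>])
  finally have R: "schur (?c \<nu>) (map inverse (xs @ [z])) = \<dots>" .
  have "schur \<nu> (xs @ [z]) =
      (\<Sum>a\<in>gt_rows \<nu>. z ^ (sum_list \<nu> - sum_list a) * schur a xs)"
    using \<nu> by (intro schur_snoc_gt) (auto simp: partitions_in_box_def)
  also have "\<dots> = (\<Sum>a\<in>gt_rows \<nu>. prod_list (xs @ [z]) ^ u *
      (inverse z ^ (sum_list (?c \<nu>) - sum_list (?c a)) * schur (?c a) (map inverse xs)))"
  proof (rule sum.cong[OF refl])
    fix a assume a: "a \<in> gt_rows \<nu>"
    define d e where "d = sum_list (?c \<nu>) - sum_list (?c a)" and "e = sum_list \<nu> - sum_list a"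
    \<comment> \<open>The rectangles used for \<open>\<nu>\<close> and \<open>a\<close> differ by
      one row of length \<open>u\<close>.\<close>
    have "e + d = u"
      using sum_list_box_compl[OF \<nu>] sum_list_box_compl[OF box[OF a]] gt_rows_sum_le[OF \<nu> a]
      by (simp add: d_def e_def)
    then have "z ^ u * inverse z ^ d = z ^ e * (z ^ d * inverse z ^ d)"
      by (metis power_add mult.assoc)
    also have "z ^ d * inverse z ^ d = 1"
      using z by (simp flip: power_mult_distrib)
    finally have "z ^ u * inverse z ^ d = z ^ e"
      by simp
    moreover have "schur a xs = prod_list xs ^ u * schur (?c a) (map inverse xs)"
      using box[OF a] xs by (rule snoc.IH)
    ultimately have "z ^ e * schur a xs =
        (z ^ u * inverse z ^ d) * (prod_list xs ^ u * schur (?c a) (map inverse xs))"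
      by simp
    then show "z ^ (sum_list \<nu> - sum_list a) * schur a xs = prod_list (xs @ [z]) ^ u *
        (inverse z ^ (sum_list (?c \<nu>) - sum_list (?c a)) * schur (?c a) (map inverse xs))"
      unfolding d_def[symmetric] e_def[symmetric]
      by (simp only: prod_list.append prod_list.Cons prod_list.Nil power_mult_distrib
          power_one mult_1_left mult_1_right mult_ac)
  qed
  finally show ?case
    unfolding R by (simp only: sum_distrib_left)
qed

section \<open>Chains of horizontal strips and symmetry\<close>

text \<open>A transfer matrix indexed by shapes. Extension by zero gives all sums the same index
  set, so that they can be swapped.\<close>

definition strip_weight :: "'a::comm_semiring_1 \<Rightarrow> nat list \<Rightarrow> nat list \<Rightarrow> 'a" where
  "strip_weight z \<nu> \<kappa> = (if \<kappa> \<in> strips \<nu> then z ^ (sum_list \<nu> - sum_list \<kappa>) else 0)"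

text \<open>An entry of a product of transfer matrices over \<open>B\<close>. The variables are
  listed from the outermost strip inwards.\<close>

primrec chain_gf :: "nat list set \<Rightarrow> 'a::comm_semiring_1 list \<Rightarrow> nat list \<Rightarrow> nat list \<Rightarrow> 'a" where
  "chain_gf B [] \<nu> \<mu> = of_bool (\<nu> = \<mu>)"
| "chain_gf B (z # zs) \<nu> \<mu> = (\<Sum>\<kappa>\<in>B. strip_weight z \<nu> \<kappa> * chain_gf B zs \<kappa> \<mu>)"

lemma sum_strip_weight:
  assumes "\<nu> \<in> partitions_in_box n u"
  shows "(\<Sum>\<kappa>\<in>partitions_in_box n u. strip_weight z \<nu> \<kappa> * f \<kappa>) =
    (\<Sum>\<kappa>\<in>strips \<nu>. z ^ (sum_list \<nu> - sum_list \<kappa>) * f \<kappa>)"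
  using strips_subset_box[OF assms]
  by (intro sum.mono_neutral_cong_right finite_partitions_in_box) (auto simp: strip_weight_def)

text \<open>Iterates the branching rule down to the empty shape. The head of \<open>zs\<close> is
  removed first, hence it is the last variable of the Schur polynomial; this explains
  \<open>rev\<close>.\<close>

lemma schur_eq_chain_gf:
  assumes "\<nu> \<in> partitions_in_box n u"
  shows "schur \<nu> (rev zs) = chain_gf (partitions_in_box n u) zs \<nu> (replicate n 0)"
  using assms
proof (induction zs arbitrary: \<nu>)
  case Nil
  then show ?case by (auto simp: schur_Nil partitions_in_box_def)
next
  case (Cons z zs)
  have "schur \<nu> (rev (z # zs)) =
      (\<Sum>\<kappa>\<in>strips \<nu>. z ^ (sum_list \<nu> - sum_list \<kappa>) * schur \<kappa> (rev zs))"
    using Cons.prems by (simp add: schur_snoc partitions_in_box_def)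
  also have "\<dots> = (\<Sum>\<kappa>\<in>partitions_in_box n u. strip_weight z \<nu> \<kappa> * schur \<kappa> (rev zs))"
    by (rule sum_strip_weight[OF Cons.prems, symmetric])
  finally show ?case by (simp add: Cons.IH)
qed

text \<open>Associativity of the matrix product: the innermost factor can be split off instead of
  the outermost. Membership of \<open>\<nu>\<close> and \<open>\<mu>\<close> in \<open>B\<close>
  makes the empty product act as the identity.\<close>

lemma chain_gf_snoc:
  assumes "finite B" "\<nu> \<in> B" "\<mu> \<in> B"
  shows "chain_gf B (zs @ [z]) \<nu> \<mu> = (\<Sum>\<kappa>\<in>B. chain_gf B zs \<nu> \<kappa> * strip_weight z \<kappa> \<mu>)"
  using assms(2)
proof (induction zs arbitrary: \<nu>)
  case Nil
  have "(\<Sum>\<kappa>\<in>B. strip_weight z \<nu> \<kappa> * of_bool (\<kappa> = \<mu>)) = strip_weight z \<nu> \<mu>"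
    using assms(1,3) by (simp add: sum.remove[of B \<mu>])
  moreover have "(\<Sum>\<kappa>\<in>B. of_bool (\<nu> = \<kappa>) * strip_weight z \<kappa> \<mu>) = strip_weight z \<nu> \<mu>"
    using assms(1) Nil by (simp add: sum.remove[of B \<nu>])
  ultimately show ?case by simp
next
  case (Cons w zs)
  have "chain_gf B ((w # zs) @ [z]) \<nu> \<mu> =
      (\<Sum>\<rho>\<in>B. \<Sum>\<kappa>\<in>B. strip_weight w \<nu> \<rho> * (chain_gf B zs \<rho> \<kappa> * strip_weight z \<kappa> \<mu>))"
    by (simp add: Cons.IH sum_distrib_left)
  also have "\<dots> = (\<Sum>\<kappa>\<in>B. \<Sum>\<rho>\<in>B. strip_weight w \<nu> \<rho> * (chain_gf B zs \<rho> \<kappa> * strip_weight z \<kappa> \<mu>))"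
    by (rule sum.swap)
  finally show ?case by (simp add: sum_distrib_right mult.assoc)
qed

text \<open>A nonzero value requires a chain of strips, along which rows can only get
  shorter.\<close>

lemma chain_gf_neq_0_le: "chain_gf B zs \<nu> \<mu> \<noteq> 0 \<Longrightarrow> list_all2 (\<le>) \<mu> \<nu>"
proof (induction zs arbitrary: \<nu>)
  case Nil
  then show ?case by (auto simp: list_all2_conv_all_nth split: if_splits)
next
  case (Cons z zs)
  then obtain \<kappa> where "strip_weight z \<nu> \<kappa> * chain_gf B zs \<kappa> \<mu> \<noteq> 0"
    by (metis (no_types, lifting) chain_gf.simps(2) sum.neutral)
  then have "\<kappa> \<in> strips \<nu>" "chain_gf B zs \<kappa> \<mu> \<noteq> 0"
    by (auto simp: strip_weight_def split: if_splits)
  then have "list_all2 (\<le>) \<kappa> \<nu>" "list_all2 (\<le>) \<mu> \<kappa>"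
    using Cons.IH by (auto simp: strips_def list_all2_conv_all_nth)
  then show ?case using list_all2_trans[of "(\<le>)" "(\<le>)" "(\<le>)"] by (metis le_trans)
qed

text \<open>
  In terms of the rows the Bender--Knuth involution reflects every row length independently
  in the interval that the two neighbouring shapes leave for it.
\<close>

definition toggle_lo :: "nat list \<Rightarrow> nat list \<Rightarrow> nat \<Rightarrow> nat" where
  "toggle_lo \<nu> \<mu> i = (if Suc i < length \<nu> then max (\<mu> ! i) (\<nu> ! Suc i) else \<mu> ! i)"

definition toggle_hi :: "nat list \<Rightarrow> nat list \<Rightarrow> nat \<Rightarrow> nat" where
  "toggle_hi \<nu> \<mu> i = (if i = 0 then \<nu> ! i else min (\<nu> ! i) (\<mu> ! (i - 1)))"

definition toggle :: "nat list \<Rightarrow> nat list \<Rightarrow> nat list \<Rightarrow> nat list" where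
  "toggle \<nu> \<mu> \<kappa> =
     map (\<lambda>i. toggle_lo \<nu> \<mu> i + toggle_hi \<nu> \<mu> i - \<kappa> ! i) [0..<length \<nu>]"

text \<open>For fixed outer shapes each inequality involves a single part of
  \<open>\<kappa>\<close>. The rows decouple, and the intermediate shapes form a product of
  intervals.\<close>

lemma between_strips_iff:
  assumes "length \<mu> = length \<nu>"
  shows "\<kappa> \<in> strips \<nu> \<and> \<mu> \<in> strips \<kappa> \<longleftrightarrow> length \<kappa> = length \<nu> \<and>
    (\<forall>i<length \<nu>. toggle_lo \<nu> \<mu> i \<le> \<kappa> ! i \<and> \<kappa> ! i \<le> toggle_hi \<nu> \<mu> i)" (is "?L \<longleftrightarrow> ?R")
proof
  assume ?L
  then have l: "length \<kappa> = length \<nu>" and k: "\<kappa> \<in> strips \<nu>" "\<mu> \<in> strips \<kappa>"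
    by (auto simp: strips_def)
  have "\<kappa> ! i \<le> \<mu> ! (i - 1)" if "0 < i" "i < length \<nu>" for i
    using stripsD(3)[OF k(2), of "i - 1"] that l by simp
  then show ?R
    using stripsD(2,3)[OF k(1)] stripsD(2)[OF k(2)] l
    by (auto simp: toggle_lo_def toggle_hi_def)
next
  assume R: ?R
  have "\<kappa> ! Suc i \<le> \<mu> ! i" if "Suc i < length \<nu>" for i
    using R that by (auto simp: toggle_hi_def dest!: spec[of _ "Suc i"])
  moreover have "\<nu> ! Suc i \<le> \<kappa> ! i" if "Suc i < length \<nu>" for i
    using R that by (auto simp: toggle_lo_def dest!: spec[of _ i])
  moreover have "\<mu> ! i \<le> \<kappa> ! i" "\<kappa> ! i \<le> \<nu> ! i" if "i < length \<nu>" for i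
    using R that by (auto simp: toggle_lo_def toggle_hi_def dest!: spec[of _ i] split: if_splits)
  ultimately show ?L
    using R assms by (simp add: strips_def)
qed

text \<open>The upper bound of row \<open>Suc i\<close> and the lower bound of row \<open>i\<close>
  are the minimum and the maximum of the same two numbers, \<open>\<nu> ! Suc i\<close> and
  \<open>\<mu> ! i\<close>. The unpaired bounds are the first part of \<open>\<nu>\<close> and the
  last part of \<open>\<mu>\<close>.\<close>

lemma sum_toggle_bounds:
  assumes "length \<mu> = length \<nu>"
  shows "(\<Sum>i<length \<nu>. toggle_lo \<nu> \<mu> i + toggle_hi \<nu> \<mu> i) = sum_list \<nu> + sum_list \<mu>"
proof (cases "length \<nu>")
  case 0
  then show ?thesis using assms by simp
next
  case (Suc n)
  have "(\<Sum>i<Suc k. toggle_hi \<nu> \<mu> i) + (\<Sum>i<k. toggle_lo \<nu> \<mu> i) =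
      (\<Sum>i<Suc k. \<nu> ! i) + (\<Sum>i<k. \<mu> ! i)" if "k \<le> n" for k
    using that
  proof (induction k)
    case 0
    then show ?case by (simp add: toggle_hi_def)
  next
    case (Suc k)
    have "toggle_hi \<nu> \<mu> (Suc k) + toggle_lo \<nu> \<mu> k = \<nu> ! Suc k + \<mu> ! k"
      using Suc.prems \<open>length \<nu> = Suc n\<close> by (simp add: toggle_hi_def toggle_lo_def min_def max_def)
    then show ?case using Suc.IH Suc.prems by simp
  qed
  from this[of n] show ?thesis
    using Suc assms
    by (simp add: sum_list_sum_nth atLeast0LessThan sum.distrib toggle_lo_def[of \<nu> \<mu> n])
qed

lemma toggle_between_strips:
  assumes "length \<mu> = length \<nu>" "\<kappa> \<in> strips \<nu>" "\<mu> \<in> strips \<kappa>"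
  shows "toggle \<nu> \<mu> \<kappa> \<in> strips \<nu>" "\<mu> \<in> strips (toggle \<nu> \<mu> \<kappa>)"
    "toggle \<nu> \<mu> (toggle \<nu> \<mu> \<kappa>) = \<kappa>"
    "sum_list (toggle \<nu> \<mu> \<kappa>) + sum_list \<kappa> = sum_list \<nu> + sum_list \<mu>"
proof -
  have \<kappa>: "length \<kappa> = length \<nu>"
    "\<And>i. i < length \<nu> \<Longrightarrow> toggle_lo \<nu> \<mu> i \<le> \<kappa> ! i \<and> \<kappa> ! i \<le> toggle_hi \<nu> \<mu> i"
    using between_strips_iff[OF assms(1), of \<kappa>] assms(2,3) by auto
  have nth: "toggle \<nu> \<mu> \<rho> ! i = toggle_lo \<nu> \<mu> i + toggle_hi \<nu> \<mu> i - \<rho> ! i"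
    if "i < length \<nu>" for i \<rho> using that by (simp add: toggle_def)
  have len: "length (toggle \<nu> \<mu> \<rho>) = length \<nu>" for \<rho> by (simp add: toggle_def)
  have "toggle_lo \<nu> \<mu> i \<le> toggle \<nu> \<mu> \<kappa> ! i \<and> toggle \<nu> \<mu> \<kappa> ! i \<le> toggle_hi \<nu> \<mu> i"
    if "i < length \<nu>" for i using \<kappa>(2)[OF that] unfolding nth[OF that] by arith
  then show "toggle \<nu> \<mu> \<kappa> \<in> strips \<nu>" "\<mu> \<in> strips (toggle \<nu> \<mu> \<kappa>)"
    using between_strips_iff[OF assms(1), of "toggle \<nu> \<mu> \<kappa>"] len by auto
  show "toggle \<nu> \<mu> (toggle \<nu> \<mu> \<kappa>) = \<kappa>"
  proof (rule nth_equalityI)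
    fix i assume "i < length (toggle \<nu> \<mu> (toggle \<nu> \<mu> \<kappa>))"
    then have "i < length \<nu>" by (simp add: len)
    then show "toggle \<nu> \<mu> (toggle \<nu> \<mu> \<kappa>) ! i = \<kappa> ! i"
      using \<kappa>(2)[of i] by (simp add: nth)
  qed (simp add: len \<kappa>(1))
  have "sum_list (toggle \<nu> \<mu> \<kappa>) + sum_list \<kappa> = (\<Sum>i<length \<nu>. toggle \<nu> \<mu> \<kappa> ! i + \<kappa> ! i)"
    by (simp add: sum_list_sum_nth len \<kappa>(1) atLeast0LessThan sum.distrib)
  also have "\<dots> = (\<Sum>i<length \<nu>. toggle_lo \<nu> \<mu> i + toggle_hi \<nu> \<mu> i)"
  proof (rule sum.cong[OF refl])
    fix i assume "i \<in> {..<length \<nu>}"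
    then show "toggle \<nu> \<mu> \<kappa> ! i + \<kappa> ! i = toggle_lo \<nu> \<mu> i + toggle_hi \<nu> \<mu> i"
      using \<kappa>(2)[of i] by (simp add: nth)
  qed
  finally show "sum_list (toggle \<nu> \<mu> \<kappa>) + sum_list \<kappa> = sum_list \<nu> + sum_list \<mu>"
    by (simp add: sum_toggle_bounds[OF assms(1)])
qed

text \<open>Transfer matrices commute: \<open>toggle\<close> exchanges the sizes of the two strips
  between \<open>\<nu>\<close> and \<open>\<mu>\<close>.\<close>

lemma strip_weight_commute:
  fixes z w :: "'a::comm_semiring_1"
  assumes \<nu>: "\<nu> \<in> partitions_in_box n u" and \<mu>: "length \<mu> = n"
  defines "B \<equiv> partitions_in_box n u"
  shows "(\<Sum>\<kappa>\<in>B. strip_weight z \<nu> \<kappa> * strip_weight w \<kappa> \<mu>) =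
    (\<Sum>\<kappa>\<in>B. strip_weight w \<nu> \<kappa> * strip_weight z \<kappa> \<mu>)"
proof -
  let ?K = "{\<kappa>. \<kappa> \<in> strips \<nu> \<and> \<mu> \<in> strips \<kappa>}"
  have len: "length \<mu> = length \<nu>"
    using \<nu> \<mu> by (simp add: partitions_in_box_def)
  have restr: "(\<Sum>\<kappa>\<in>B. strip_weight p \<nu> \<kappa> * strip_weight q \<kappa> \<mu>) =
      (\<Sum>\<kappa>\<in>?K. p ^ (sum_list \<nu> - sum_list \<kappa>) * q ^ (sum_list \<kappa> - sum_list \<mu>))" for p q :: 'a
    using strips_subset_box[OF \<nu>] unfolding B_def
    by (intro sum.mono_neutral_cong_right finite_partitions_in_box) (auto simp: strip_weight_def)
  show ?thesis
    unfolding restr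
  proof (rule sum.reindex_bij_witness[where i = "toggle \<nu> \<mu>" and j = "toggle \<nu> \<mu>"])
    fix \<kappa> assume "\<kappa> \<in> ?K"
    then have k: "\<kappa> \<in> strips \<nu>" "\<mu> \<in> strips \<kappa>" by auto
    note t = toggle_between_strips[OF len k]
    show "toggle \<nu> \<mu> (toggle \<nu> \<mu> \<kappa>) = \<kappa>" "toggle \<nu> \<mu> \<kappa> \<in> ?K"
      "toggle \<nu> \<mu> (toggle \<nu> \<mu> \<kappa>) = \<kappa>" "toggle \<nu> \<mu> \<kappa> \<in> ?K"
      using t by auto
    have "sum_list \<nu> - sum_list (toggle \<nu> \<mu> \<kappa>) = sum_list \<kappa> - sum_list \<mu>"
      "sum_list (toggle \<nu> \<mu> \<kappa>) - sum_list \<mu> = sum_list \<nu> - sum_list \<kappa>"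
      using t(4) sum_list_strips_le[OF k(1)] sum_list_strips_le[OF k(2)] by auto
    then show "w ^ (sum_list \<nu> - sum_list (toggle \<nu> \<mu> \<kappa>)) * z ^ (sum_list (toggle \<nu> \<mu> \<kappa>) - sum_list \<mu>)
        = z ^ (sum_list \<nu> - sum_list \<kappa>) * w ^ (sum_list \<kappa> - sum_list \<mu>)"
      by (simp add: mult.commute)
  qed
qed

text \<open>The variable \<open>z\<close> moves to the front past one variable after another, by
  \<open>strip_weight_commute\<close>.\<close>

lemma chain_gf_rotate:
  fixes zs :: "'a::comm_semiring_1 list"
  assumes "\<nu> \<in> partitions_in_box n u" "\<mu> \<in> partitions_in_box n u"
  defines "B \<equiv> partitions_in_box n u"
  shows "chain_gf B (zs @ [z]) \<nu> \<mu> = chain_gf B (z # zs) \<nu> \<mu>"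
  using assms(1)
proof (induction zs arbitrary: \<nu>)
  case (Cons w zs)
  have "chain_gf B ((w # zs) @ [z]) \<nu> \<mu> =
      (\<Sum>\<kappa>\<in>B. strip_weight w \<nu> \<kappa> * (\<Sum>\<rho>\<in>B. strip_weight z \<kappa> \<rho> * chain_gf B zs \<rho> \<mu>))"
    using Cons.IH by (simp add: B_def)
  also have "\<dots> = (\<Sum>\<rho>\<in>B. (\<Sum>\<kappa>\<in>B. strip_weight w \<nu> \<kappa> * strip_weight z \<kappa> \<rho>) * chain_gf B zs \<rho> \<mu>)"
    unfolding sum_distrib_left sum_distrib_right mult.assoc by (rule sum.swap)
  also have "\<dots> = (\<Sum>\<rho>\<in>B. (\<Sum>\<kappa>\<in>B. strip_weight z \<nu> \<kappa> * strip_weight w \<kappa> \<rho>) * chain_gf B zs \<rho> \<mu>)"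
    using strip_weight_commute[OF Cons.prems, of _ w z] unfolding B_def
    by (intro sum.cong) (auto simp: partitions_in_box_def)
  also have "\<dots> = (\<Sum>\<kappa>\<in>B. strip_weight z \<nu> \<kappa> * (\<Sum>\<rho>\<in>B. strip_weight w \<kappa> \<rho> * chain_gf B zs \<rho> \<mu>))"
    unfolding sum_distrib_left sum_distrib_right mult.assoc by (rule sum.swap)
  finally show ?case by simp
qed simp

text \<open>In \<open>rev zs @ [z]\<close> the last variable is rotated to the front, and the
  induction hypothesis reverses the rest.\<close>

lemma chain_gf_rev:
  assumes "\<nu> \<in> partitions_in_box n u" "\<mu> \<in> partitions_in_box n u"
  shows "chain_gf (partitions_in_box n u) (rev zs) \<nu> \<mu> = chain_gf (partitions_in_box n u) zs \<nu> \<mu>"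
  using assms(1)
proof (induction zs arbitrary: \<nu>)
  case (Cons z zs)
  then show ?case using assms(2) by (simp add: chain_gf_rotate del: chain_gf.simps) simp
qed simp

text \<open>Complementation reverses inclusion, and a half-turn maps columns to columns; the strip
  stays horizontal while its inner and outer shapes change roles.\<close>

lemma box_compl_strips:
  assumes "\<nu> \<in> partitions_in_box n u" "\<kappa> \<in> strips \<nu>"
  shows "box_compl u \<nu> \<in> strips (box_compl u \<kappa>)"
proof -
  have l: "length \<kappa> = length \<nu>"
    using assms(2) by (simp add: strips_def)
  have "\<nu> ! (length \<nu> - Suc i) \<le> \<kappa> ! (length \<nu> - Suc (Suc i))" if "Suc i < length \<nu>" for i
    using stripsD(3)[OF assms(2), of "length \<nu> - Suc (Suc i)"] that Suc_diff_Suc[OF that] by simp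
  moreover have "\<kappa> ! (length \<nu> - Suc i) \<le> \<nu> ! (length \<nu> - Suc i)" if "i < length \<nu>" for i
    using that by (intro stripsD(2)[OF assms(2)]) simp
  ultimately show ?thesis
    by (auto simp: strips_def nth_box_compl l intro!: diff_le_mono2)
qed

lemma strip_weight_box_compl:
  assumes \<nu>: "\<nu> \<in> partitions_in_box n u" and \<kappa>: "\<kappa> \<in> partitions_in_box n u"
  shows "strip_weight z (box_compl u \<kappa>) (box_compl u \<nu>) = strip_weight z \<nu> \<kappa>"
proof -
  have "box_compl u \<nu> \<in> strips (box_compl u \<kappa>) \<longleftrightarrow> \<kappa> \<in> strips \<nu>"
    using box_compl_strips[OF \<nu>] box_compl_strips[OF box_compl_in_box[OF \<kappa>]]
    by (metis \<kappa> \<nu> box_compl_box_compl)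
  moreover have "sum_list (box_compl u \<kappa>) - sum_list (box_compl u \<nu>) = sum_list \<nu> - sum_list \<kappa>"
    using sum_list_box_compl[OF \<nu>] sum_list_box_compl[OF \<kappa>] by simp
  ultimately show ?thesis by (simp add: strip_weight_def)
qed

lemma bij_betw_box_compl: "bij_betw (box_compl u) (partitions_in_box n u) (partitions_in_box n u)"
  by (rule bij_betw_byWitness[where f' = "box_compl u"])
    (auto simp: box_compl_box_compl box_compl_in_box)

text \<open>The complements of the shapes in a chain form a chain read backwards, so the end points
  and the order of the variables are reversed.\<close>

lemma chain_gf_box_compl:
  assumes "\<nu> \<in> partitions_in_box n u" "\<mu> \<in> partitions_in_box n u"
  defines "B \<equiv> partitions_in_box n u"
  shows "chain_gf B (rev zs) (box_compl u \<mu>) (box_compl u \<nu>) = chain_gf B zs \<nu> \<mu>"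
  using assms(1)
proof (induction zs arbitrary: \<nu>)
  case Nil
  then show ?case using assms(2) by (auto simp: dest: box_compl_box_compl) (metis box_compl_box_compl)
next
  case (Cons z zs)
  let ?c = "box_compl u"
  have "chain_gf B (rev (z # zs)) (?c \<mu>) (?c \<nu>) =
      (\<Sum>\<kappa>\<in>B. chain_gf B (rev zs) (?c \<mu>) \<kappa> * strip_weight z \<kappa> (?c \<nu>))"
    using Cons.prems assms(2)
    by (simp add: B_def chain_gf_snoc box_compl_in_box finite_partitions_in_box)
  also have "\<dots> = (\<Sum>\<kappa>\<in>B. chain_gf B (rev zs) (?c \<mu>) (?c \<kappa>) * strip_weight z (?c \<kappa>) (?c \<nu>))"
    unfolding B_def by (rule sum.reindex_bij_betw[OF bij_betw_box_compl, symmetric])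
  also have "\<dots> = (\<Sum>\<kappa>\<in>B. strip_weight z \<nu> \<kappa> * chain_gf B zs \<kappa> \<mu>)"
    using Cons.IH Cons.prems
    by (intro sum.cong) (auto simp: B_def strip_weight_box_compl mult.commute)
  finally show ?case by simp
qed

section \<open>The shape \<open>(u\<^sup>n, v\<^sup>m)\<close>\<close>

text \<open>The last \<open>k\<close> parts are squeezed between two copies of \<open>v\<close>. The
  first \<open>length b\<close> parts form a strip of \<open>b\<close> bounded below by
  \<open>v\<close>.\<close>

lemma gt_rows_append_replicate:
  assumes "\<forall>i<length b. v \<le> b ! i"
  shows "gt_rows (b @ replicate (Suc k) v) =
    (\<lambda>b'. b' @ replicate k v) ` {b' \<in> strips b. \<forall>i<length b. v \<le> b' ! i}" (is "_ = ?f ` ?S")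
proof (intro equalityI subsetI)
  fix a assume a: "a \<in> gt_rows (b @ replicate (Suc k) v)"
  let ?n = "length b"
  have nth: "(b @ replicate (Suc k) v) ! i = (if i < ?n then b ! i else v)" if "i \<le> ?n + k" for i
    using that by (simp add: nth_append del: replicate.simps)
  have l: "length a = ?n + k"
    using a by (simp add: gt_rows_def)
  have up: "a ! i \<le> (b @ replicate (Suc k) v) ! i"
    and lo: "(b @ replicate (Suc k) v) ! Suc i \<le> a ! i" if "i < ?n + k" for i
    using a that unfolding gt_rows_def by auto
  have "drop ?n a = replicate k v"
  proof (rule nth_equalityI)
    fix i assume "i < length (drop ?n a)"
    then have i: "i < k" by (simp add: l)
    then show "drop ?n a ! i = replicate k v ! i"
      using up[of "?n + i"] lo[of "?n + i"] by (simp add: nth l del: replicate.simps)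
  qed (simp add: l)
  then have "a = take ?n a @ replicate k v"
    by (metis append_take_drop_id)
  moreover have "take ?n a \<in> ?S"
  proof -
    have "a ! i \<le> b ! i" if "i < ?n" for i
      using up[of i] that by (simp add: nth_append)
    moreover have "b ! Suc i \<le> a ! i" if "Suc i < ?n" for i
      using lo[of i] that by (simp add: nth_append)
    \<comment> \<open>For the last free row the lower neighbour is the first \<open>v\<close> of the
      block, a bound that \<open>strips b\<close> does not supply.\<close>
    moreover have "v \<le> a ! i" if "i < ?n" for i
      using lo[of i] that assms
      by (cases "Suc i < ?n") (auto simp: nth simp del: replicate.simps intro: order_trans)
    ultimately show ?thesis by (simp add: strips_def l)
  qed
  ultimately show "a \<in> ?f ` ?S" by blast
next
  fix a assume "a \<in> ?f ` ?S"
  then obtain b' where a: "a = b' @ replicate k v" and b': "b' \<in> strips b"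
    and v: "\<forall>i<length b. v \<le> b' ! i"
    by blast
  have nth: "(b @ replicate (Suc k) v) ! i = (if i < length b then b ! i else v)"
    if "i \<le> length b + k" for i
    using that by (simp add: nth_append del: replicate.simps)
  show "a \<in> gt_rows (b @ replicate (Suc k) v)"
    unfolding gt_rows_def a using stripsD[OF b'] v
    by (auto simp: nth nth_append[of b'] simp del: replicate.simps)
qed

text \<open>
  Peeling off the last variables one by one, only the first \<open>n\<close> rows of the intermediate shapes
  are free, and they never drop below \<open>v\<close>.
\<close>

lemma schur_append_replicate:
  fixes xs ys :: "'a::comm_semiring_1 list"
  assumes "b \<in> partitions_in_box n u" "\<forall>i<n. v \<le> b ! i" "length xs = n"
  defines "B \<equiv> partitions_in_box n u"
  shows "schur (b @ replicate (length ys) v) (xs @ rev ys) =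
    prod_list ys ^ v * (\<Sum>\<kappa>\<in>{\<kappa>\<in>B. \<forall>i<n. v \<le> \<kappa> ! i}. chain_gf B ys b \<kappa> * schur \<kappa> xs)"
  using assms(1,2)
proof (induction ys arbitrary: b)
  case Nil
  have "finite {\<kappa>\<in>B. \<forall>i<n. v \<le> \<kappa> ! i}"
    by (simp add: B_def finite_partitions_in_box)
  then show ?case
    using Nil by (simp add: of_bool_def if_distribR if_distrib[of "\<lambda>x. x * _"] B_def cong: if_cong)
next
  case (Cons z ys)
  let ?k = "length ys"
  let ?K = "{\<kappa>\<in>B. \<forall>i<n. v \<le> \<kappa> ! i}"
  let ?S = "{b' \<in> strips b. \<forall>i<n. v \<le> b' ! i}"
  have b: "length b = n" "sorted_wrt (\<ge>) b" "\<forall>p\<in>set b. v \<le> p"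
    using Cons.prems by (auto simp: partitions_in_box_def all_set_conv_all_nth)
  have sub: "strips b \<subseteq> B"
    unfolding B_def by (rule strips_subset_box[OF Cons.prems(1)])
  have "schur (b @ replicate (Suc ?k) v) ((xs @ rev ys) @ [z]) =
      (\<Sum>a\<in>gt_rows (b @ replicate (Suc ?k) v).
        z ^ (sum_list (b @ replicate (Suc ?k) v) - sum_list a) * schur a (xs @ rev ys))"
    using b assms(3)
    by (intro schur_snoc_gt) (auto simp: sorted_wrt_append sorted_wrt_iff_nth_less[of _ "replicate _ _"] simp del: replicate.simps)
  also have "\<dots> = (\<Sum>b'\<in>?S. z ^ (sum_list (b @ replicate (Suc ?k) v) -
      sum_list (b' @ replicate ?k v)) * schur (b' @ replicate ?k v) (xs @ rev ys))"
    using gt_rows_append_replicate[of b v ?k] Cons.prems(2) b(1)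
    by (simp add: sum.reindex inj_on_def del: replicate.simps)
  \<comment> \<open>With \<open>z\<close> one row of length \<open>v\<close> disappears; it
    contributes the factor \<open>z ^ v\<close>.\<close>
  also have "\<dots> = (\<Sum>b'\<in>?S. z ^ v * z ^ (sum_list b - sum_list b') * (prod_list ys ^ v *
      (\<Sum>\<kappa>\<in>?K. chain_gf B ys b' \<kappa> * schur \<kappa> xs)))"
  proof (rule sum.cong[OF refl])
    fix b' assume b': "b' \<in> ?S"
    then have "sum_list (b @ replicate (Suc ?k) v) - sum_list (b' @ replicate ?k v) =
        v + (sum_list b - sum_list b')"
      using sum_list_strips_le[of b' b] by (simp add: sum_list_replicate)
    moreover have "schur (b' @ replicate ?k v) (xs @ rev ys) =
        prod_list ys ^ v * (\<Sum>\<kappa>\<in>?K. chain_gf B ys b' \<kappa> * schur \<kappa> xs)"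
      using b' sub by (intro Cons.IH) (auto simp: B_def)
    ultimately show "z ^ (sum_list (b @ replicate (Suc ?k) v) - sum_list (b' @ replicate ?k v)) *
        schur (b' @ replicate ?k v) (xs @ rev ys) = z ^ v * z ^ (sum_list b - sum_list b') *
        (prod_list ys ^ v * (\<Sum>\<kappa>\<in>?K. chain_gf B ys b' \<kappa> * schur \<kappa> xs))"
      by (simp add: power_add)
  qed
  also have "\<dots> = (\<Sum>b'\<in>strips b. z ^ v * z ^ (sum_list b - sum_list b') * (prod_list ys ^ v *
      (\<Sum>\<kappa>\<in>?K. chain_gf B ys b' \<kappa> * schur \<kappa> xs)))"
  proof (rule sum.mono_neutral_left[OF finite_strips])
    show "\<forall>b'\<in>strips b - ?S. z ^ v * z ^ (sum_list b - sum_list b') * (prod_list ys ^ v *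
      (\<Sum>\<kappa>\<in>?K. chain_gf B ys b' \<kappa> * schur \<kappa> xs)) = 0"
    proof
      fix b' assume "b' \<in> strips b - ?S"
      then obtain i where i: "i < n" "\<not> v \<le> b' ! i" by auto
      have "chain_gf B ys b' \<kappa> = 0" if "\<kappa> \<in> ?K" for \<kappa>
      proof (rule ccontr)
        assume "chain_gf B ys b' \<kappa> \<noteq> 0"
        then have "\<kappa> ! i \<le> b' ! i"
          using that i by (auto dest!: chain_gf_neq_0_le simp: list_all2_conv_all_nth B_def partitions_in_box_def)
        then show False using that i by force
      qed
      then show "z ^ v * z ^ (sum_list b - sum_list b') * (prod_list ys ^ v *
          (\<Sum>\<kappa>\<in>?K. chain_gf B ys b' \<kappa> * schur \<kappa> xs)) = 0"
        by simp
    qed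
  qed auto
  also have "\<dots> = prod_list (z # ys) ^ v * (\<Sum>b'\<in>strips b. z ^ (sum_list b - sum_list b') *
      (\<Sum>\<kappa>\<in>?K. chain_gf B ys b' \<kappa> * schur \<kappa> xs))"
    unfolding sum_distrib_left[of "prod_list (z # ys) ^ v"] by (simp add: power_mult_distrib mult_ac)
  also have "(\<Sum>b'\<in>strips b. z ^ (sum_list b - sum_list b') *
      (\<Sum>\<kappa>\<in>?K. chain_gf B ys b' \<kappa> * schur \<kappa> xs)) =
      (\<Sum>b'\<in>B. strip_weight z b b' * (\<Sum>\<kappa>\<in>?K. chain_gf B ys b' \<kappa> * schur \<kappa> xs))"
    unfolding B_def by (rule sum_strip_weight[OF Cons.prems(1), symmetric])
  also have "\<dots> = (\<Sum>\<kappa>\<in>?K. chain_gf B (z # ys) b \<kappa> * schur \<kappa> xs)"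
    unfolding chain_gf.simps sum_distrib_left sum_distrib_right mult.assoc by (rule sum.swap)
  finally show ?case by simp
qed

text \<open>Shapes with more nonzero rows than there are variables contribute nothing, so only the
  first \<open>l\<close> rows matter.\<close>

lemma sum_schur_pad_zeros:
  fixes ys :: "'a::comm_semiring_1 list"
  assumes "l = min n (length ys)"
  shows "(\<Sum>\<nu>\<in>partitions_in_box n c. f \<nu> * schur \<nu> ys) =
    (\<Sum>\<mu>\<in>partitions_in_box l c. f (\<mu> @ replicate (n - l) 0) * schur \<mu> ys)"
proof -
  let ?p = "\<lambda>\<mu>. \<mu> @ replicate (n - l) (0::nat)"
  have "(\<Sum>\<nu>\<in>partitions_in_box n c. f \<nu> * schur \<nu> ys) =
      (\<Sum>\<nu>\<in>?p ` partitions_in_box l c. f \<nu> * schur \<nu> ys)"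
  proof (rule sum.mono_neutral_right[OF finite_partitions_in_box])
    show "?p ` partitions_in_box l c \<subseteq> partitions_in_box n c"
      using assms by (auto simp: partitions_in_box_def sorted_wrt_append
          sorted_wrt_iff_nth_less[of _ "replicate _ _"])
    show "\<forall>\<nu>\<in>partitions_in_box n c - ?p ` partitions_in_box l c. f \<nu> * schur \<nu> ys = 0"
    proof
      fix \<nu> assume \<nu>: "\<nu> \<in> partitions_in_box n c - ?p ` partitions_in_box l c"
      then have len: "length \<nu> = n" and s: "sorted_wrt (\<ge>) \<nu>"
        by (auto simp: partitions_in_box_def)
      have "take l \<nu> \<in> partitions_in_box l c"
        using \<nu> assms by (auto simp: partitions_in_box_def sorted_wrt_take dest: in_set_takeD)
      then have "drop l \<nu> \<noteq> replicate (n - l) 0"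
        using \<nu> by (metis (no_types, lifting) DiffD2 append_take_drop_id image_eqI)
      then obtain k where "k < n - l" "\<nu> ! (l + k) > 0"
        using len by (auto simp: list_eq_iff_nth_eq)
      then obtain i where i: "l \<le> i" "i < n" "\<nu> ! i > 0"
        by (metis le_add1 less_diff_conv2 less_diff_conv add.commute)
      \<comment> \<open>The index \<open>i\<close> lies in the range from \<open>l\<close> to below
        \<open>n\<close>, which rules out \<open>l = n\<close>.\<close>
      then have "l = length ys" using assms by auto
      moreover have "\<nu> ! i \<le> \<nu> ! l"
        using i len by (intro sorted_ge_nth[OF s]) auto
      ultimately have "schur \<nu> ys = 0"
        using i len by (intro schur_eq_0 s) auto
      then show "f \<nu> * schur \<nu> ys = 0" by simp
    qed
  qed
  then show ?thesis
    by (simp add: sum.reindex inj_on_def schur_append_zeros)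
qed

theorem theorem4p11:
  fixes n m l u v :: nat and x y :: "'a::field list"
  assumes "n \<ge> 1" and "m \<ge> 1"
    and "l = min n m"
    and "v \<le> u"
    and "length x = n" and "length y = m"
    and "\<forall>i<n. x ! i \<noteq> 0"
  shows "schur (replicate n u @ replicate m v) (x @ y) =
    (\<Prod>i<n. x ! i) ^ u * (\<Prod>i<m. y ! i) ^ v *
    (\<Sum>\<mu>\<in>partitions_in_box l (u - v).
       schur (\<mu> @ replicate (n - l) 0) (map inverse x) *
       schur (\<mu> @ replicate (m - l) 0) y)"
proof -
  define B where "B = partitions_in_box n u"
  let ?c = "box_compl u"
  let ?K = "{\<kappa>\<in>B. \<forall>i<n. v \<le> \<kappa> ! i}"
  have top: "replicate n u \<in> partitions_in_box n u" and bot: "replicate n 0 \<in> partitions_in_box n u"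
    by (auto simp: partitions_in_box_iff sorted_wrt_iff_nth_less)
  have "?c (replicate n u) = replicate n 0"
    by (simp add: box_compl_def)
  have prods: "prod_list x = (\<Prod>i<n. x ! i)" "prod_list y = (\<Prod>i<m. y ! i)"
    using assms(5,6) prod.list_conv_set_nth[of x] prod.list_conv_set_nth[of y]
    by (simp_all add: atLeast0LessThan)
  \<comment> \<open>The list is \<open>rev y\<close> because \<open>schur_append_replicate\<close>
    reads the variables from the outermost strip inwards.\<close>
  have "schur (replicate n u @ replicate m v) (x @ y) = prod_list (rev y) ^ v *
      (\<Sum>\<kappa>\<in>?K. chain_gf B (rev y) (replicate n u) \<kappa> * schur \<kappa> x)"
    using schur_append_replicate[OF top, of v x "rev y"] assms(4-6) by (simp add: B_def)
  also have "(\<Sum>\<kappa>\<in>?K. chain_gf B (rev y) (replicate n u) \<kappa> * schur \<kappa> x) =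
      (\<Sum>\<kappa>\<in>?K. prod_list x ^ u * (schur (?c \<kappa>) (map inverse x) * schur (?c \<kappa>) y))"
  proof (rule sum.cong[OF refl])
    fix \<kappa> assume "\<kappa> \<in> ?K"
    then have \<kappa>: "\<kappa> \<in> partitions_in_box n u" by (simp add: B_def)
    \<comment> \<open>A chain starting at the full rectangle becomes one ending at the empty shape,
      with the variables in the wrong order for \<open>schur_eq_chain_gf\<close>; symmetry in the
      next step repairs this.\<close>
    have "chain_gf B (rev y) (replicate n u) \<kappa> = chain_gf B y (?c \<kappa>) (replicate n 0)"
      using chain_gf_box_compl[OF top \<kappa>, of "rev y"]
      by (simp add: B_def \<open>?c (replicate n u) = replicate n 0\<close>)
    also have "\<dots> = chain_gf B (rev y) (?c \<kappa>) (replicate n 0)"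
      unfolding B_def by (rule chain_gf_rev[OF box_compl_in_box[OF \<kappa>] bot, symmetric])
    also have "\<dots> = schur (?c \<kappa>) y"
      using schur_eq_chain_gf[OF box_compl_in_box[OF \<kappa>], of "rev y"] by (simp add: B_def)
    finally have "chain_gf B (rev y) (replicate n u) \<kappa> = schur (?c \<kappa>) y" .
    moreover have "schur \<kappa> x = prod_list x ^ u * schur (?c \<kappa>) (map inverse x)"
      using \<kappa> assms(5,7) by (intro schur_box_compl) (auto simp: in_set_conv_nth)
    ultimately show "chain_gf B (rev y) (replicate n u) \<kappa> * schur \<kappa> x =
        prod_list x ^ u * (schur (?c \<kappa>) (map inverse x) * schur (?c \<kappa>) y)"
      by (simp add: mult_ac)
  qed
  also have "\<dots> = prod_list x ^ u * (\<Sum>\<kappa>\<in>?K. schur (?c \<kappa>) (map inverse x) * schur (?c \<kappa>) y)"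
    by (simp only: sum_distrib_left)
  \<comment> \<open>Complementing turns the lower bound \<open>v\<close> on the rows into the upper
    bound \<open>u - v\<close>.\<close>
  also have "(\<Sum>\<kappa>\<in>?K. schur (?c \<kappa>) (map inverse x) * schur (?c \<kappa>) y) =
      (\<Sum>\<nu>\<in>partitions_in_box n (u - v). schur \<nu> (map inverse x) * schur \<nu> y)"
  proof (rule sum.reindex_bij_witness[where i = ?c and j = ?c])
    fix \<kappa> assume \<kappa>: "\<kappa> \<in> ?K"
    then show "?c (?c \<kappa>) = \<kappa>"
      by (simp add: B_def box_compl_box_compl[of _ n])
    show "?c \<kappa> \<in> partitions_in_box n (u - v)"
      using \<kappa> box_compl_in_box[of \<kappa> n u]
      by (auto simp: B_def partitions_in_box_iff nth_box_compl intro!: diff_le_mono2)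
  next
    fix \<nu> assume \<nu>: "\<nu> \<in> partitions_in_box n (u - v)"
    then have \<nu>': "\<nu> \<in> partitions_in_box n u"
      by (force simp: partitions_in_box_iff)
    then show "?c (?c \<nu>) = \<nu>"
      by (rule box_compl_box_compl)
    have "v \<le> u - \<nu> ! i" if "i < n" for i
      using \<nu> that assms(4) by (force simp: partitions_in_box_iff)
    then show "?c \<nu> \<in> ?K"
      using \<nu>' box_compl_in_box[OF \<nu>'] by (auto simp: B_def nth_box_compl partitions_in_box_iff)
  qed simp
  \<comment> \<open>The number of variables \<open>y\<close> limits the rows to \<open>l\<close>;
    the factor in the inverses of \<open>x\<close> is carried along as the coefficient.\<close>
  also have "\<dots> = (\<Sum>\<mu>\<in>partitions_in_box l (u - v).
      schur (\<mu> @ replicate (n - l) 0) (map inverse x) * schur \<mu> y)"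
    using assms(3,6) by (intro sum_schur_pad_zeros) simp
  finally show ?thesis
    by (simp add: prods schur_append_zeros mult_ac)
qed

end
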